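(* Let $k\ge 2$ and $d\ge 3$ be integers. Let $q$ range over odd prime powers, $q\to\infty$, and let $\mathcal{E}=\mathcal{E}_q\subseteq\mathbb{F}_q^d$ be sets such that $q^{\frac{d}{2}+\frac{1}{2k}}=o(|\mathcal{E}|)$, i.e. $q^{\frac{d}{2}+\frac{1}{2k}}/|\mathcal{E}|\to 0$ as $q\to\infty$. Then \[|k\Delta_{\mathbb{F}_q}(\mathcal{E})|=(1-o(1))q,\] i.e. $|k\Delta_{\mathbb{F}_q}(\mathcal{E})|/q\to 1$ as $q\to\infty$.
   Context: $\mathbb{F}_q$ is the finite field of order $q$. For $\mathbf{x},\mathbf{y}\in\mathbb{F}_q^d$ put $||\mathbf{x}-\mathbf{y}||=(x_1-y_1)^2+\cdots+(x_d-y_d)^2\in\mathbb{F}_q$. For $\mathcal{E}\subseteq\mathbb{F}_q^d$, the distance set is $\Delta_{\mathbb{F}_q}(\mathcal{E})=\{||\mathbf{x}-\mathbf{y}||\colon \mathbf{x},\mathbf{y}\in\mathcal{E}\}\subseteq\mathbb{F}_q$, and $k\Delta_{\mathbb{F}_q}(\mathcal{E})=\Delta_{\mathbb{F}_q}(\mathcal{E})+\cdots+\Delta_{\mathbb{F}_q}(\mathcal{E})$ ($k$ times) is the $k$-fold sumset $\{t_1+\cdots+t_k\colon t_i\in\Delta_{\mathbb{F}_q}(\mathcal{E})\}$. The notation $X=o(Y)$ means $X/Y\to 0$ as $q\to\infty$, where $X,Y$ are viewed as functions of $q$. *)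

theory Defs
  imports
    "HOL-Algebra.Ring"
    "HOL-Algebra.Coset"
    "HOL-Number_Theory.Prime_Powers"
    "HOL-Library.Landau_Symbols"
begin

text \<open>
  The coordinate space over a ring \<open>R\<close> with carrier in \<open>'a\<close>. Vectors are extensional functions on
  \<open>{..<d}\<close>, so that distinct functions are distinct vectors and cardinalities are the intended ones.
\<close>

definition coord_space :: "('a, 'm) ring_scheme \<Rightarrow> nat \<Rightarrow> (nat \<Rightarrow> 'a) set" where
  "coord_space R d = {..<d} \<rightarrow>\<^sub>E carrier R"

definition distance :: "('a, 'm) ring_scheme \<Rightarrow> nat \<Rightarrow> (nat \<Rightarrow> 'a) \<Rightarrow> (nat \<Rightarrow> 'a) \<Rightarrow> 'a" where
  "distance R d x y = (\<Oplus>\<^bsub>R\<^esub>i\<in>{..<d}. (x i \<ominus>\<^bsub>R\<^esub> y i) [^]\<^bsub>R\<^esub> (2::nat))"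

definition distance_set :: "('a, 'm) ring_scheme \<Rightarrow> nat \<Rightarrow> (nat \<Rightarrow> 'a) set \<Rightarrow> 'a set" where
  "distance_set R d E = {distance R d x y | x y. x \<in> E \<and> y \<in> E}"

definition sumset :: "('a, 'm) ring_scheme \<Rightarrow> nat \<Rightarrow> 'a set \<Rightarrow> 'a set" where
  "sumset R k A = {\<Oplus>\<^bsub>R\<^esub>i\<in>{..<k}. t i | t. t \<in> {..<k} \<rightarrow> A}"

text \<open>The filter for limits as \<open>q\<close> tends to infinity through the odd prime powers.\<close>

definition odd_primepows_at_top :: "nat filter" where
  "odd_primepows_at_top = inf at_top (principal {q. odd q \<and> primepow q})"

end

theory Submission
  imports Defs "HOL-Algebra.Multiplicative_Group"
begin

text \<open>
  Since \<open>k\<Delta>(E) = \<Delta>(E\<^sup>k)\<close> with \<open>E\<^sup>k\<close> in dimension \<open>D = kd\<close>, a single distance set suffices. Call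
  a point \<open>x\<close> incident with a pair \<open>(y, t)\<close> if \<open>x\<close> and \<open>y\<close> are at distance \<open>t\<close>. Each point is
  incident with \<open>q\<^sup>D\<close> of the \<open>q\<^bsup>D+1\<^esup>\<close> pairs, and two distinct points have at most \<open>q\<^bsup>D-1\<^esup>\<close> common
  pairs, because the difference of their distances to \<open>y\<close> is a nonconstant affine function of \<open>y\<close>.
  So the incidences of distinct points with a random pair are not positively correlated. The pairs
  \<open>(y, t)\<close> with \<open>y \<in> A = E\<^sup>k\<close> and \<open>t \<in> T\<close>, the set of missing distances, are incident with no
  point of \<open>A\<close>, and Chebyshev's inequality bounds their number: \<open>|T| |A|\<^sup>2 \<le> q\<^bsup>D+2\<^esup>\<close>.
\<close>

section \<open>Second moments in a finite incidence structure\<close>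

text \<open>Chebyshev's inequality for the number of points of \<open>P\<close> incident with a
  random \<open>l\<close> in \<open>L\<close>: the mean is \<open>card P * r / card L\<close>,
  \<open>codeg\<close> makes the covariances of distinct points nonpositive, and every
  \<open>l\<close> in \<open>H\<close> deviates by the whole mean.\<close>

lemma card_non_incident_le:
  fixes inc :: "'p \<Rightarrow> 'l \<Rightarrow> bool"
  assumes fin: "finite P" "finite L"
    and deg: "\<And>p. p \<in> P \<Longrightarrow> card {l \<in> L. inc p l} = r"
    and codeg: "\<And>p p'. p \<in> P \<Longrightarrow> p' \<in> P \<Longrightarrow> p \<noteq> p' \<Longrightarrow>
      card L * card {l \<in> L. inc p l \<and> inc p' l} \<le> r\<^sup>2"
    and H: "H \<subseteq> L" "\<And>p l. p \<in> P \<Longrightarrow> l \<in> H \<Longrightarrow> \<not> inc p l"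
  shows "card H * card P * r \<le> (card L)\<^sup>2"
proof (cases "card P * r = 0")
  case True
  then show ?thesis by auto
next
  case False
  define n where "n = real (card L)"
  define m where "m = real (card P)"
  define N where "N l = (\<Sum>p\<in>P. of_bool (inc p l) :: real)" for l
  have N1: "(\<Sum>l\<in>L. N l) = m * r"
  proof -
    have "(\<Sum>l\<in>L. N l) = (\<Sum>p\<in>P. \<Sum>l\<in>L. of_bool (inc p l))"
      unfolding N_def by (rule sum.swap)
    also have "\<dots> = (\<Sum>p\<in>P. real r)"
      using fin deg by (intro sum.cong) (simp_all add: Int_def)
    finally show ?thesis by (simp add: m_def)
  qed
  have N2: "n * (\<Sum>l\<in>L. (N l)\<^sup>2) \<le> n * m * r + m\<^sup>2 * r\<^sup>2"
  proof -
    have "(\<Sum>l\<in>L. (N l)\<^sup>2) = (\<Sum>l\<in>L. \<Sum>p\<in>P. \<Sum>p'\<in>P. of_bool (inc p l \<and> inc p' l))"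
      unfolding N_def power2_eq_square sum_product by (intro sum.cong refl) auto
    also have "\<dots> = (\<Sum>p\<in>P. \<Sum>l\<in>L. \<Sum>p'\<in>P. of_bool (inc p l \<and> inc p' l))"
      by (rule sum.swap)
    also have "\<dots> = (\<Sum>p\<in>P. \<Sum>p'\<in>P. \<Sum>l\<in>L. of_bool (inc p l \<and> inc p' l))"
      by (intro sum.cong refl sum.swap)
    also have "\<dots> = (\<Sum>p\<in>P. \<Sum>p'\<in>P. real (card {l \<in> L. inc p l \<and> inc p' l}))"
      using fin by (intro sum.cong refl) (simp add: Int_def)
    finally have "n * (\<Sum>l\<in>L. (N l)\<^sup>2)
        = (\<Sum>p\<in>P. \<Sum>p'\<in>P. real (card L * card {l \<in> L. inc p l \<and> inc p' l}))"
      by (simp add: n_def sum_distrib_left)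
    \<comment> \<open>By \<open>deg\<close> a diagonal term equals \<open>n * r\<close>; granting it
      \<open>r\<^sup>2\<close> on top makes the second summand uniform over all pairs.\<close>
    also have "\<dots> \<le> (\<Sum>p\<in>P. \<Sum>p'\<in>P. (if p' = p then n * r else 0) + real (r\<^sup>2))"
    proof (intro sum_mono)
      fix p p' assume "p \<in> P" "p' \<in> P"
      then show "real (card L * card {l \<in> L. inc p l \<and> inc p' l})
          \<le> (if p' = p then n * r else 0) + real (r\<^sup>2)"
        using deg[of p] codeg[of p p'] of_nat_le_iff[where ?'a = real]
        by (cases "p' = p") (simp_all add: n_def flip: of_nat_mult of_nat_add)
    qed
    also have "\<dots> = n * m * r + m\<^sup>2 * r\<^sup>2"
      using fin by (simp add: sum.distrib m_def algebra_simps power2_eq_square)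
    finally show ?thesis .
  qed
  \<comment> \<open>Deviations from the mean \<open>m * r / n\<close> are scaled by \<open>n\<close>
    to avoid division. On \<open>H\<close> the count \<open>N l\<close> is zero.\<close>
  have "card H * (m * r)\<^sup>2 = (\<Sum>l\<in>H. (n * N l - m * r)\<^sup>2)"
    using H(2) by (simp add: N_def)
  also have "\<dots> \<le> (\<Sum>l\<in>L. (n * N l - m * r)\<^sup>2)"
    using fin H(1) by (intro sum_mono2) auto
  also have "\<dots> = n * (n * (\<Sum>l\<in>L. (N l)\<^sup>2)) - 2 * n * m * r * (\<Sum>l\<in>L. N l) + n * (m * r)\<^sup>2"
    by (simp add: power2_diff sum.distrib sum_subtractf sum_distrib_left n_def)
       (simp add: algebra_simps power2_eq_square)
  also have "\<dots> \<le> n * (n * m * r + m\<^sup>2 * r\<^sup>2) - 2 * n * m * r * (m * r) + n * (m * r)\<^sup>2"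
    unfolding N1 using N2 by (intro add_right_mono diff_right_mono mult_left_mono) (auto simp: n_def)
  also have "\<dots> = n\<^sup>2 * (m * r)"
    by (simp add: algebra_simps power2_eq_square)
  finally have "(card H * (m * r)) * (m * r) \<le> n\<^sup>2 * (m * r)"
    by (simp add: power2_eq_square mult.assoc)
  moreover have "m * r > 0"
    using False by (simp add: m_def)
  ultimately have "card H * (m * r) \<le> n\<^sup>2"
    by (rule mult_right_le_imp_le)
  then have "real (card H * card P * r) \<le> real ((card L)\<^sup>2)"
    by (simp add: m_def n_def mult.assoc)
  then show ?thesis
    by (simp only: of_nat_le_iff)
qed

section \<open>Odd characteristic, identities for squares, iterated sums\<close>

lemma (in ring) add_pow_even_one:
  assumes "\<one> \<oplus> \<one> = \<zero>"
  shows "[(2 * m :: nat)] \<cdot> \<one> = \<zero>"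
proof (induction m)
  case (Suc m)
  have "[(2 * Suc m :: nat)] \<cdot> \<one> = [(2 * m :: nat)] \<cdot> \<one> \<oplus> \<one> \<oplus> \<one>"
    by (simp add: add.nat_pow_Suc)
  then show ?case
    using assms by (simp add: Suc.IH)
qed simp

text \<open>Lagrange's theorem in the additive group: \<open>order R\<close> copies of
  \<open>\<one>\<close> add up to \<open>\<zero>\<close>, but if
  \<open>\<one> \<oplus> \<one> = \<zero>\<close>, an odd number of copies adds up to
  \<open>\<one>\<close>.\<close>

lemma (in field) one_plus_one_neq_zero:
  assumes "odd (order R)"
  shows "\<one> \<oplus> \<one> \<noteq> \<zero>"
proof
  assume "\<one> \<oplus> \<one> = \<zero>"
  moreover obtain m where "order R = 2 * m + 1"
    using assms by (rule oddE)
  ultimately have "[order R] \<cdot> \<one> = \<one>"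
    using add_pow_even_one by simp
  moreover have "[order R] \<cdot> \<one> = \<zero>"
    using add.pow_order_eq_1[of \<one>] by (simp add: order_def)
  ultimately show False
    by simp
qed

text \<open>All pure squares cancel in this second difference and only mixed products survive. In a
  field where \<open>\<one> \<oplus> \<one> \<noteq> \<zero>\<close> it therefore vanishes only if
  \<open>x = x'\<close> or \<open>y = y'\<close>.\<close>

lemma (in cring) diff_diff_squares:
  assumes "x \<in> carrier R" "x' \<in> carrier R" "y \<in> carrier R" "y' \<in> carrier R"
  shows "((x \<ominus> y) [^] (2::nat) \<ominus> (x' \<ominus> y) [^] (2::nat)) \<ominus> ((x \<ominus> y') [^] (2::nat) \<ominus> (x' \<ominus> y') [^] (2::nat))
    = (\<one> \<oplus> \<one>) \<otimes> ((x \<ominus> x') \<otimes> (y' \<ominus> y))"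
  using assms by (simp add: numeral_2_eq_2) algebra

lemma (in cring) diff_eq_diff_if_add_eq_add:
  assumes "a \<oplus> e = b \<oplus> c"
    and "a \<in> carrier R" "b \<in> carrier R" "c \<in> carrier R" "e \<in> carrier R"
  shows "a \<ominus> b = c \<ominus> e"
proof -
  have "a \<ominus> b = (a \<oplus> e) \<ominus> (b \<oplus> e)"
    using assms(2-) by algebra
  also have "\<dots> = (b \<oplus> c) \<ominus> (b \<oplus> e)"
    by (simp only: assms(1))
  also have "\<dots> = c \<ominus> e"
    using assms(2-) by algebra
  finally show ?thesis .
qed

text \<open>Its additive instance \<open>add.finprod_Times\<close> cuts a sum over
  \<open>k * d\<close> coordinates into \<open>k\<close> blocks of length \<open>d\<close>.\<close>

lemma (in comm_monoid) finprod_Times: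
  assumes "finite A" "finite B" "f \<in> A \<times> B \<rightarrow> carrier G"
  shows "(\<Otimes>p\<in>A \<times> B. f p) = (\<Otimes>a\<in>A. \<Otimes>b\<in>B. f (a, b))"
  using assms(1,3)
proof (induction A)
  case (insert a A)
  have "(\<Otimes>p\<in>{a} \<times> B. f p) = (\<Otimes>p\<in>Pair a ` B. f p)"
    by (intro arg_cong[where f = "finprod G f"]) auto
  also have "\<dots> = (\<Otimes>b\<in>B. f (a, b))"
    using insert.prems by (intro finprod_reindex) (auto simp: inj_on_def)
  finally have "(\<Otimes>p\<in>{a} \<times> B. f p) = (\<Otimes>b\<in>B. f (a, b))" .
  moreover have "insert a A \<times> B = {a} \<times> B \<union> A \<times> B"
    by auto
  moreover have "(\<Otimes>p\<in>{a} \<times> B \<union> A \<times> B. f p) = (\<Otimes>p\<in>{a} \<times> B. f p) \<otimes> (\<Otimes>p\<in>A \<times> B. f p)"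
    using insert assms(2) by (intro finprod_Un_disjoint) auto
  moreover have "(\<Otimes>a\<in>insert a A. \<Otimes>b\<in>B. f (a, b))
      = (\<Otimes>b\<in>B. f (a, b)) \<otimes> (\<Otimes>a\<in>A. \<Otimes>b\<in>B. f (a, b))"
    using insert by (intro finprod_insert) (auto intro!: finprod_closed)
  ultimately show ?case
    using insert by auto
qed simp

section \<open>Distances over an arbitrary index set\<close>

text \<open>A general index set admits both pairs (block, coordinate) and a set of coordinates with
  one removed.\<close>

definition sqdist :: "('a, 'm) ring_scheme \<Rightarrow> 'j set \<Rightarrow> ('j \<Rightarrow> 'a) \<Rightarrow> ('j \<Rightarrow> 'a) \<Rightarrow> 'a" where
  "sqdist R J x y = (\<Oplus>\<^bsub>R\<^esub>j\<in>J. (x j \<ominus>\<^bsub>R\<^esub> y j) [^]\<^bsub>R\<^esub> (2::nat))"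

lemma (in ring) sqdist_closed:
  assumes "x \<in> J \<rightarrow>\<^sub>E carrier R" "y \<in> J \<rightarrow>\<^sub>E carrier R"
  shows "sqdist R J x y \<in> carrier R"
  unfolding sqdist_def using assms by (intro finsum_closed) (auto simp: PiE_iff)

text \<open>At a coordinate \<open>i\<close> where \<open>x\<close> and \<open>x'\<close> differ,
  the condition is affine in \<open>y i\<close> with nonzero slope, so the other coordinates of
  \<open>y\<close> determine \<open>y i\<close>.\<close>

lemma (in field) card_equidistant_le:
  assumes fin: "finite (carrier R)" "finite J"
    and two: "\<one> \<oplus> \<one> \<noteq> \<zero>"
    and x: "x \<in> J \<rightarrow>\<^sub>E carrier R" "x' \<in> J \<rightarrow>\<^sub>E carrier R" "x \<noteq> x'"
  shows "order R * card {y \<in> J \<rightarrow>\<^sub>E carrier R. sqdist R J x y = sqdist R J x' y} \<le> order R ^ card J"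
proof -
  define S where "S = {y \<in> J \<rightarrow>\<^sub>E carrier R. sqdist R J x y = sqdist R J x' y}"
  obtain i where i: "i \<in> J" "x i \<noteq> x' i"
    using x by (meson PiE_ext)
  define K where "K = J - {i}"
  have K: "finite K" "i \<notin> K" "J = insert i K"
    using i fin by (auto simp: K_def)
  have split: "sqdist R J u y = (u i \<ominus> y i) [^] (2::nat) \<oplus> sqdist R K u y"
    if "u \<in> J \<rightarrow>\<^sub>E carrier R" "y \<in> J \<rightarrow>\<^sub>E carrier R" for u y
    unfolding sqdist_def K(3) using that K by (intro finsum_insert) (auto simp: PiE_iff)
  have "inj_on (\<lambda>y. restrict y K) S"
  proof (rule inj_onI)
    fix y y' assume y: "y \<in> S" "y' \<in> S" and eq: "restrict y K = restrict y' K"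
    have yc: "y \<in> J \<rightarrow>\<^sub>E carrier R" "y' \<in> J \<rightarrow>\<^sub>E carrier R"
      using y by (auto simp: S_def)
    have yK: "y j = y' j" if "j \<in> K" for j
      using eq that by (metis restrict_apply')
    have same: "sqdist R K u y' = sqdist R K u y" if "u \<in> J \<rightarrow>\<^sub>E carrier R" for u
      unfolding sqdist_def using that yc K yK
      by (intro finsum_cong') (auto simp: PiE_iff)
    have cl: "sqdist R K x y \<in> carrier R" "sqdist R K x' y \<in> carrier R"
      using x yc K unfolding sqdist_def by (auto intro!: finsum_closed simp: PiE_iff)
    have ci: "x i \<in> carrier R" "x' i \<in> carrier R" "y i \<in> carrier R" "y' i \<in> carrier R"
      using x yc i by auto
    \<comment> \<open>The right side does not depend on \<open>z\<close>, because \<open>y\<close>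
      and \<open>y'\<close> agree on \<open>K\<close>. The instances \<open>y i\<close> and
      \<open>y' i\<close> thus have second difference zero.\<close>
    have e: "(x i \<ominus> z) [^] (2::nat) \<ominus> (x' i \<ominus> z) [^] (2::nat) = sqdist R K x' y \<ominus> sqdist R K x y"
      if "z \<in> {y i, y' i}" for z
    proof -
      have "(x i \<ominus> z) [^] (2::nat) \<oplus> sqdist R K x y = (x' i \<ominus> z) [^] (2::nat) \<oplus> sqdist R K x' y"
        using y that x yc by (auto simp: S_def split same)
      then show ?thesis
        using cl ci that by (intro diff_eq_diff_if_add_eq_add) auto
    qed
    have "(\<one> \<oplus> \<one>) \<otimes> ((x i \<ominus> x' i) \<otimes> (y' i \<ominus> y i)) = \<zero>"
      using cl e by (simp add: diff_diff_squares[OF ci, symmetric])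
    then have "y' i \<ominus> y i = \<zero>"
      using two i ci integral_iff by (metis a_closed m_closed minus_closed one_closed r_right_minus_eq)
    then have "y' i = y i"
      using ci by simp
    then show "y = y'"
      using yc yK K(3) by (intro PiE_ext[OF yc]) auto
  qed
  moreover have "(\<lambda>y. restrict y K) ` S \<subseteq> K \<rightarrow>\<^sub>E carrier R"
    using K by (auto simp: S_def PiE_iff)
  ultimately have "card S \<le> card (K \<rightarrow>\<^sub>E carrier R)"
    using fin K by (intro card_inj_on_le) (auto intro!: finite_PiE)
  then have "order R * card S \<le> order R ^ card J"
    using K by (simp add: card_PiE order_def)
  then show ?thesis
    by (simp add: S_def)
qed

text \<open>The incidence bound with \<open>H = A \<times> T\<close>, \<open>r = q ^ card J\<close>
  and \<open>card L = q ^ (card J + 1)\<close>; one factor \<open>q ^ card J\<close>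
  cancels.\<close>

lemma (in field) card_missing_distances_le:
  assumes fin: "finite (carrier R)" "finite J"
    and two: "\<one> \<oplus> \<one> \<noteq> \<zero>"
    and A: "A \<subseteq> J \<rightarrow>\<^sub>E carrier R"
    and T: "T \<subseteq> carrier R" "\<And>x y. x \<in> A \<Longrightarrow> y \<in> A \<Longrightarrow> sqdist R J x y \<notin> T"
  shows "card T * (card A)\<^sup>2 \<le> order R ^ (card J + 2)"
proof -
  define q where "q = order R"
  define L where "L = (J \<rightarrow>\<^sub>E carrier R) \<times> carrier R"
  define inc where "inc x l \<longleftrightarrow> sqdist R J x (fst l) = snd l" for x l
  have q: "q > 0"
    using fin by (auto simp: q_def order_def card_gt_0_iff)
  have cJ: "card (J \<rightarrow>\<^sub>E carrier R) = q ^ card J"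
    using fin by (simp add: card_PiE q_def order_def)
  have cL: "card L = q ^ (card J + 1)"
    by (simp add: L_def card_cartesian_product cJ q_def order_def)
  \<comment> \<open>The pairs incident with \<open>x\<close> form the graph of a function of
    \<open>y\<close>. Taking \<open>Q\<close> constantly true yields the degree, and
    \<open>Q = inc x'\<close> the codegree.\<close>
  have graph: "card {l \<in> L. inc x l \<and> Q l} = card {y \<in> J \<rightarrow>\<^sub>E carrier R. Q (y, sqdist R J x y)}"
    if "x \<in> A" for x Q
  proof -
    have "{l \<in> L. inc x l \<and> Q l}
        = (\<lambda>y. (y, sqdist R J x y)) ` {y \<in> J \<rightarrow>\<^sub>E carrier R. Q (y, sqdist R J x y)}"
      using that A by (auto simp: L_def inc_def intro!: sqdist_closed)
    then show ?thesis
      by (simp add: card_image inj_on_def)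
  qed
  have "card (A \<times> T) * card A * q ^ card J \<le> (card L)\<^sup>2"
  proof (rule card_non_incident_le)
    show "finite A"
      using A fin by (meson finite_PiE finite_subset)
    show "finite L"
      using fin by (auto simp: L_def intro!: finite_PiE)
    show "card {l \<in> L. inc x l} = q ^ card J" if "x \<in> A" for x
      using graph[OF that, of "\<lambda>_. True"] cJ by simp
    show "card L * card {l \<in> L. inc x l \<and> inc x' l} \<le> (q ^ card J)\<^sup>2"
      if "x \<in> A" "x' \<in> A" "x \<noteq> x'" for x x'
    proof -
      have "card {l \<in> L. inc x l \<and> inc x' l}
          = card {y \<in> J \<rightarrow>\<^sub>E carrier R. sqdist R J x y = sqdist R J x' y}"
        using graph[OF that(1), of "inc x'"] by (simp add: inc_def eq_commute)
      then have "q * card {l \<in> L. inc x l \<and> inc x' l} \<le> q ^ card J"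
        using card_equidistant_le[OF fin two, of x x'] that A by (auto simp: q_def)
      then have "q ^ card J * (q * card {l \<in> L. inc x l \<and> inc x' l}) \<le> q ^ card J * q ^ card J"
        by (rule mult_le_mono2)
      then show ?thesis
        by (simp add: cL power2_eq_square ac_simps)
    qed
    show "A \<times> T \<subseteq> L"
      using A T by (auto simp: L_def)
    show "\<not> inc x l" if "x \<in> A" "l \<in> A \<times> T" for x l
      using that T by (auto simp: inc_def)
  qed
  then have "q ^ card J * (card T * (card A)\<^sup>2) \<le> q ^ card J * q ^ (card J + 2)"
    unfolding cL by (simp add: card_cartesian_product power2_eq_square power_add ac_simps)
  then show ?thesis
    using q by (simp add: q_def)
qed

section \<open>From the sumset to a single distance set\<close>

text \<open>Distances between points of the \<open>k\<close>-fold power of \<open>E\<close> lie in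
  the sumset, so the complement of the sumset can serve as the set of missing distances in dimension
  \<open>k * d\<close>.\<close>

lemma (in field) card_missing_sumset_le:
  assumes fin: "finite (carrier R)" and odd: "odd (order R)"
    and E: "E \<subseteq> coord_space R d"
  shows "card (carrier R - sumset R k (distance_set R d E)) * card E ^ (2 * k) \<le> order R ^ (k * d + 2)"
proof -
  define J where "J = {..<k} \<times> {..<d}"
  \<comment> \<open>Concatenation of \<open>k\<close> vectors; restricting to \<open>J\<close> keeps
    the result extensional.\<close>
  define flat where "flat f = (\<lambda>p\<in>J. f (fst p) (snd p))" for f :: "nat \<Rightarrow> nat \<Rightarrow> 'a"
  define A where "A = flat ` ({..<k} \<rightarrow>\<^sub>E E)"
  have Ecl: "f i j \<in> carrier R" if "f \<in> {..<k} \<rightarrow>\<^sub>E E" "i < k" "j < d" for f i j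
    using that E by (force simp: coord_space_def PiE_iff)
  have "inj_on flat ({..<k} \<rightarrow>\<^sub>E E)"
  proof (rule inj_onI)
    fix f g assume fg: "f \<in> {..<k} \<rightarrow>\<^sub>E E" "g \<in> {..<k} \<rightarrow>\<^sub>E E" and eq: "flat f = flat g"
    show "f = g"
    proof (rule PiE_ext[OF fg])
      fix i assume i: "i \<in> {..<k}"
      have "f i \<in> {..<d} \<rightarrow>\<^sub>E carrier R" "g i \<in> {..<d} \<rightarrow>\<^sub>E carrier R"
        using fg i E by (auto simp: coord_space_def)
      then show "f i = g i"
      proof (rule PiE_ext)
        fix j assume "j \<in> {..<d}"
        then show "f i j = g i j"
          using fun_cong[OF eq, of "(i, j)"] i by (simp add: flat_def J_def)
      qed
    qed
  qed
  then have "card A = card E ^ k"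
    by (simp add: A_def card_image card_PiE)
  moreover have "card (carrier R - sumset R k (distance_set R d E)) * (card A)\<^sup>2 \<le> order R ^ (card J + 2)"
  proof (rule card_missing_distances_le[OF fin _ one_plus_one_neq_zero[OF odd]])
    show "finite J"
      by (simp add: J_def)
    show "A \<subseteq> J \<rightarrow>\<^sub>E carrier R"
      using Ecl by (auto simp: A_def flat_def J_def)
    show "sqdist R J x y \<notin> carrier R - sumset R k (distance_set R d E)"
      if xy: "x \<in> A" "y \<in> A" for x y
    proof -
      obtain f g where fg: "f \<in> {..<k} \<rightarrow>\<^sub>E E" "g \<in> {..<k} \<rightarrow>\<^sub>E E" "x = flat f" "y = flat g"
        using xy by (auto simp: A_def)
      have "sqdist R J x y = (\<Oplus>i\<in>{..<k}. \<Oplus>j\<in>{..<d}. (x (i, j) \<ominus> y (i, j)) [^] (2::nat))"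
        unfolding sqdist_def J_def using fg Ecl
        by (intro add.finprod_Times) (auto simp: flat_def J_def)
      also have "\<dots> = (\<Oplus>i\<in>{..<k}. distance R d (f i) (g i))"
        unfolding distance_def using fg Ecl
        by (intro add.finprod_cong' add.finprod_closed)
           (auto simp: flat_def J_def intro!: add.finprod_cong' add.finprod_closed)
      also have "\<dots> \<in> sumset R k (distance_set R d E)"
        unfolding sumset_def distance_set_def using fg(1,2)
        by (intro CollectI exI[of _ "\<lambda>i. distance R d (f i) (g i)"]) blast
      finally show ?thesis
        by simp
    qed
  qed auto
  ultimately show ?thesis
    by (simp add: J_def card_cartesian_product power_mult mult.commute)
qed

lemma (in ring) sumset_subset_carrier:
  assumes "A \<subseteq> carrier R"
  shows "sumset R k A \<subseteq> carrier R"
  using assms by (auto simp: sumset_def intro!: finsum_closed)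

lemma (in ring) distance_set_subset_carrier:
  assumes "E \<subseteq> coord_space R d"
  shows "distance_set R d E \<subseteq> carrier R"
  using assms by (fastforce simp: distance_set_def distance_def coord_space_def intro!: finsum_closed)

section \<open>Passage to the limit\<close>

text \<open>The \<open>2 * k\<close>-th power of the threshold is exactly
  \<open>q ^ (k * d + 1)\<close>, so the missing proportion is at most the \<open>2 * k\<close>-th
  power of threshold over \<open>card E\<close>.\<close>

lemma (in field) card_sumset_distance_set_ge:
  fixes k d :: nat
  assumes odd: "odd (order R)" and E: "E \<subseteq> coord_space R d" and pos: "card E > 0" and k: "k > 0"
  defines "q \<equiv> real (order R)"
  shows "card (sumset R k (distance_set R d E)) / q \<le> 1"
    and "1 - (q powr (real d / 2 + 1 / (2 * real k)) / card E) ^ (2 * k)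
      \<le> card (sumset R k (distance_set R d E)) / q"
proof -
  let ?S = "sumset R k (distance_set R d E)"
  \<comment> \<open>An infinite carrier would have order 0, which is even.\<close>
  have fin: "finite (carrier R)" and q: "q > 0"
    using odd by (auto simp: order_def q_def odd_pos intro: card_ge_0_finite)
  have sub: "?S \<subseteq> carrier R"
    using sumset_subset_carrier distance_set_subset_carrier[OF E] by blast
  then have "card ?S \<le> order R"
    using fin by (simp add: order_def card_mono)
  then show "card ?S / q \<le> 1"
    using q by (simp add: q_def)
  have "(q powr (real d / 2 + 1 / (2 * real k))) ^ (2 * k) = q powr (real (2 * k) * (real d / 2 + 1 / (2 * real k)))"
    using q by (simp add: powr_power mult.commute)
  also have "real (2 * k) * (real d / 2 + 1 / (2 * real k)) = real (k * d + 1)"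
    using k by (simp add: field_simps)
  finally have pw: "(q powr (real d / 2 + 1 / (2 * real k))) ^ (2 * k) = q ^ (k * d + 1)"
    using q by (simp only: powr_realpow)
  have "real (card (carrier R - ?S) * card E ^ (2 * k)) \<le> real (order R ^ (k * d + 2))"
    using card_missing_sumset_le[OF fin odd E, of k] by (simp only: of_nat_le_iff)
  then have "card (carrier R - ?S) \<le> q ^ (k * d + 2) / card E ^ (2 * k)"
    using pos by (simp add: q_def pos_le_divide_eq)
  moreover have "real (card (carrier R - ?S)) = q - card ?S"
    using \<open>card ?S \<le> order R\<close> sub fin by (simp add: card_Diff_subset finite_subset q_def order_def)
  ultimately have "q - card ?S \<le> q * (q ^ (k * d + 1) / card E ^ (2 * k))"
    by simp
  then show "1 - (q powr (real d / 2 + 1 / (2 * real k)) / card E) ^ (2 * k) \<le> card ?S / q"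
    unfolding power_divide pw using q by (simp add: field_simps)
qed

theorem theorem1p10:
  fixes k d :: nat
    and F :: "nat \<Rightarrow> 'a ring"
    and E :: "nat \<Rightarrow> (nat \<Rightarrow> 'a) set"
  assumes "k \<ge> 2" and "d \<ge> 3"
    and "\<And>q. odd q \<Longrightarrow> primepow q \<Longrightarrow> field (F q)"
    and "\<And>q. odd q \<Longrightarrow> primepow q \<Longrightarrow> order (F q) = q"
    and "\<And>q. odd q \<Longrightarrow> primepow q \<Longrightarrow> E q \<subseteq> coord_space (F q) d"
    and "(\<lambda>q. real q powr (real d / 2 + 1 / (2 * real k)))
           \<in> o[odd_primepows_at_top](\<lambda>q. real (card (E q)))"
  shows "((\<lambda>q. real (card (sumset (F q) k (distance_set (F q) d (E q)))) / real q) \<longlongrightarrow> 1)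
           odd_primepows_at_top"
proof (rule tendsto_sandwich)
  let ?f = "\<lambda>q. real q powr (real d / 2 + 1 / (2 * real k))"
  let ?e = "\<lambda>q. real (card (E q))"
  have qs: "\<forall>\<^sub>F q in odd_primepows_at_top. odd q \<and> primepow q"
    by (auto simp: odd_primepows_at_top_def eventually_inf_principal)
  \<comment> \<open>The little-o bound with constant 1 forces \<open>card (E q)\<close> to be
    positive eventually, as the division by it requires.\<close>
  have "\<forall>\<^sub>F q in odd_primepows_at_top. norm (?f q) \<le> 1 * norm (?e q)"
    using assms(6) by (rule landau_o.smallD) simp
  with qs have ev: "\<forall>\<^sub>F q in odd_primepows_at_top. odd q \<and> primepow q \<and> card (E q) > 0"
  proof eventually_elim
    case (elim q)
    then have "?f q > 0"
      by (auto simp: odd_pos)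
    with elim show ?case
      by (cases "card (E q) = 0") auto
  qed
  show "\<forall>\<^sub>F q in odd_primepows_at_top. 1 - (?f q / ?e q) ^ (2 * k)
      \<le> card (sumset (F q) k (distance_set (F q) d (E q))) / real q"
    using ev
  proof eventually_elim
    case (elim q)
    then interpret field "F q"
      using assms(3) by blast
    show ?case
      using card_sumset_distance_set_ge(2)[of "E q" d k] elim assms by simp
  qed
  show "\<forall>\<^sub>F q in odd_primepows_at_top. card (sumset (F q) k (distance_set (F q) d (E q))) / real q \<le> 1"
    using ev
  proof eventually_elim
    case (elim q)
    then interpret field "F q"
      using assms(3) by blast
    show ?case
      using card_sumset_distance_set_ge(1)[of "E q" d k] elim assms by simp
  qed
  have "((\<lambda>q. ?f q / ?e q) \<longlongrightarrow> 0) odd_primepows_at_top"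
    using assms(6) by (rule smalloD_tendsto)
  then have "((\<lambda>q. 1 - (?f q / ?e q) ^ (2 * k)) \<longlongrightarrow> 1 - 0 ^ (2 * k)) odd_primepows_at_top"
    by (intro tendsto_intros)
  then show "((\<lambda>q. 1 - (?f q / ?e q) ^ (2 * k)) \<longlongrightarrow> 1) odd_primepows_at_top"
    using assms(1) by (simp add: power_0_left)
qed (rule tendsto_const)

end
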